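(* Let $n\ge 2$, $q\ge 1$, $\mathcal{D}=\mathbb{C}[D_1,\dots,D_n]$, $\mathcal{F}=\mathcal{C}^\infty(\mathsf{PT})_{\mathsf{fin}}$, and let $\mathcal{M}\subset\mathcal{D}^q$ be a submodule. For $a\in\mathbb{Q}^n$ let $V(a)=\{m(a)\in\mathbb{C}^q : m\in\mathcal{M}\}$, a linear subspace of $\mathbb{C}^q$. Then $\mathcal{M}^\perp\subset\mathcal{F}^q$ consists of the elements $f(x)=\sum_{a\in\mathbb{Q}^n}c_ae^{\imath\langle a,x\rangle}$ (with $c_a\in\mathbb{C}^q$, finitely many nonzero) such that $\langle v,c_a\rangle=0$ for all $a\in\mathbb{Q}^n$ and all $v\in V(a)$; and the Willems closure $\mathcal{M}^{\perp\perp}$ with respect to $\mathcal{F}$ consists of the elements $r\in\mathcal{D}^q$ such that $r(a)\in V(a)$ for each $a\in\mathbb{Q}^n$.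
   Context: $\mathcal{D}=\mathbb{C}[D_1,\dots,D_n]$ is the commutative polynomial ring of constant coefficient differential operators on $\mathbb{R}^n$, with $D_j=\frac{1}{\imath}\frac{\partial}{\partial x_j}$. For $m=(m_1,\dots,m_q)\in\mathcal{D}^q$ and $a\in\mathbb{C}^n$, $m(a)=(m_1(a),\dots,m_q(a))\in\mathbb{C}^q$, where $m_i(a)$ is the polynomial $m_i$ evaluated at $D_j=a_j$. For $v,c\in\mathbb{C}^q$, $\langle v,c\rangle=\sum_jv_jc_j$ (bilinear), and $\langle a,x\rangle=\sum_ja_jx_j$. $\mathcal{C}^\infty(\mathsf{PT})_{\mathsf{fin}}$ is the $\mathcal{D}$-module of finite sums $\sum_{a\in\mathbb{Q}^n}c_ae^{\imath\langle a,x\rangle}$, $c_a\in\mathbb{C}$. For a submodule $\mathcal{M}\subset\mathcal{D}^q$, its behavior is $\mathcal{M}^\perp=\{(f_1,\dots,f_q)\in\mathcal{F}^q : \sum_j r_j(f_j)=0 \text{ for all } (r_1,\dots,r_q)\in\mathcal{M}\}$. For a behavior $\mathcal{B}\subset\mathcal{F}^q$, $\mathcal{B}^\perp=\{(r_1,\dots,r_q)\in\mathcal{D}^q : \sum_j r_j(f_j)=0 \text{ for all } (f_1,\dots,f_q)\in\mathcal{B}\}$. The Willems closure of $\mathcal{M}$ is $\mathcal{M}^{\perp\perp}$. *)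

theory Defs
  imports "HOL-Analysis.Analysis" "HOL-Library.Poly_Mapping"
begin

(* The ring C[D_1,...,D_n], with the indeterminates indexed by a type with n elements:
   exponent vectors 'n => nat of finite support, mapped to coefficients.
   The ring multiplication on this type is convolution. *)
type_synonym 'n dpoly = "('n \<Rightarrow>\<^sub>0 nat) \<Rightarrow>\<^sub>0 complex"

type_synonym 'n signal = "(real, 'n) vec \<Rightarrow> complex"

interpretation dpoly_vec: module "(*s) :: 'n dpoly \<Rightarrow> 'n dpoly ^ 'q \<Rightarrow> 'n dpoly ^ 'q"
  by unfold_locales
    (auto simp: vec_eq_iff distrib_left distrib_right mult.assoc)

definition dpoly_eval :: "complex ^ 'n \<Rightarrow> ('n::finite) dpoly \<Rightarrow> complex" where
  "dpoly_eval a p =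
     (\<Sum>\<alpha>\<in>Poly_Mapping.keys p.
        Poly_Mapping.lookup p \<alpha> * (\<Prod>j\<in>UNIV. (a $ j) ^ Poly_Mapping.lookup \<alpha> j))"

definition dpoly_vec_eval :: "complex ^ 'n \<Rightarrow> ('n::finite) dpoly ^ 'q \<Rightarrow> complex ^ 'q" where
  "dpoly_vec_eval a m = (\<chi> i. dpoly_eval a (m $ i))"

definition D_op :: "'n \<Rightarrow> ('n::finite) signal \<Rightarrow> 'n signal" where
  "D_op j f = (\<lambda>x. (1 / \<i>) * vector_derivative (\<lambda>t. f (x + t *\<^sub>R axis j 1)) (at 0))"

(* The partial derivatives commute on smooth functions, but not on arbitrary ones, so a
   monomial in the D_j has to be applied in some fixed order of the variables;
   the linear order on the index type serves only this purpose. *)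
definition D_monom ::
  "('n::{finite,linorder} \<Rightarrow>\<^sub>0 nat) \<Rightarrow> 'n signal \<Rightarrow> 'n signal" where
  "D_monom \<alpha> f =
     foldr (\<lambda>j. D_op j ^^ Poly_Mapping.lookup \<alpha> j) (sorted_list_of_set UNIV) f"

definition dpoly_act ::
  "('n::{finite,linorder}) dpoly \<Rightarrow> 'n signal \<Rightarrow> 'n signal" where
  "dpoly_act p f =
     (\<lambda>x. \<Sum>\<alpha>\<in>Poly_Mapping.keys p. Poly_Mapping.lookup p \<alpha> * D_monom \<alpha> f x)"

(* Bilinear, also over the complex numbers: no conjugation. *)
definition pairing :: "'a::comm_semiring_0 ^ 'k::finite \<Rightarrow> 'a ^ 'k \<Rightarrow> 'a" where
  "pairing v w = (\<Sum>j\<in>UNIV. v $ j * w $ j)"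

definition of_rat_vec :: "rat ^ 'n::finite \<Rightarrow> 'a::field_char_0 ^ 'n" where
  "of_rat_vec a = (\<chi> j. of_rat (a $ j))"

definition exp_fun :: "rat ^ 'n::finite \<Rightarrow> 'n signal" where
  "exp_fun a x = exp (\<i> * complex_of_real (pairing (of_rat_vec a) x))"

definition PT_fin :: "('n::finite) signal set" where
  "PT_fin = {(\<lambda>x. \<Sum>a | c a \<noteq> 0. c a * exp_fun a x) |
               c :: rat ^ 'n \<Rightarrow> complex. finite {a. c a \<noteq> 0}}"

definition exp_sum_vec ::
  "(rat ^ 'n::finite \<Rightarrow> complex ^ 'q::finite) \<Rightarrow> 'n signal ^ 'q" where
  "exp_sum_vec c = (\<chi> i. (\<lambda>x. \<Sum>a | c a \<noteq> 0. c a $ i * exp_fun a x))"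

definition annihilates ::
  "('n::{finite,linorder}) dpoly ^ 'q::finite \<Rightarrow> 'n signal ^ 'q \<Rightarrow> bool" where
  "annihilates r f \<longleftrightarrow> (\<forall>x. (\<Sum>j\<in>UNIV. dpoly_act (r $ j) (f $ j) x) = 0)"

definition behavior ::
  "'n signal set \<Rightarrow> (('n::{finite,linorder}) dpoly ^ 'q::finite) set \<Rightarrow>
   ('n signal ^ 'q) set" where
  "behavior F M = {f. (\<forall>j. f $ j \<in> F) \<and> (\<forall>r\<in>M. annihilates r f)}"

definition behavior_annihilator ::
  "('n signal ^ 'q) set \<Rightarrow>
   (('n::{finite,linorder}) dpoly ^ 'q::finite) set" where
  "behavior_annihilator B = {r. \<forall>f\<in>B. annihilates r f}"

definition willems_closure ::
  "'n signal set \<Rightarrow> (('n::{finite,linorder}) dpoly ^ 'q::finite) set \<Rightarrow>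
   ('n dpoly ^ 'q) set" where
  "willems_closure F M = behavior_annihilator (behavior F M)"

definition value_space :: "(('n::finite) dpoly ^ 'q::finite) set \<Rightarrow> rat ^ 'n \<Rightarrow> (complex ^ 'q) set" where
  "value_space M a = {dpoly_vec_eval (of_rat_vec a) m | m. m \<in> M}"

end

theory Submission
  imports Defs
begin

text \<open>Each exponential with frequency vector a is a simultaneous eigenfunction of all the D_j, with
eigenvalue a_j, so an operator p multiplies it by p(a). Since exponentials with distinct
frequencies are linearly independent, an equation r(f) = 0 decouples into one bilinear condition
on each coefficient vector c_a. The Willems closure then follows frequency by frequency from the
fact that a proper subspace of a finite-dimensional space can be separated from any vector outside
it by a linear functional.\<close>

section \<open>Evaluation at a point, value spaces and separation of subspaces\<close>

lemma dpoly_eval_superset: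
  assumes "finite S" "Poly_Mapping.keys p \<subseteq> S"
  shows "dpoly_eval a p =
    (\<Sum>\<alpha>\<in>S. Poly_Mapping.lookup p \<alpha> * (\<Prod>j\<in>UNIV. (a $ j) ^ Poly_Mapping.lookup \<alpha> j))"
  unfolding dpoly_eval_def using assms
  by (intro sum.mono_neutral_left) (auto simp: in_keys_iff)

lemma dpoly_eval_add: "dpoly_eval a (p + q) = dpoly_eval a p + dpoly_eval a q"
proof -
  let ?S = "Poly_Mapping.keys p \<union> Poly_Mapping.keys q"
  \<comment> \<open>Cancellation may remove keys from the sum, so all three evaluations are taken
    over the union.\<close>
  have "Poly_Mapping.keys (p + q) \<subseteq> ?S" by (rule Poly_Mapping.keys_add)
  then show ?thesis
    by (simp add: dpoly_eval_superset[of ?S] lookup_add distrib_right sum.distrib)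
qed

lemma dpoly_eval_0: "dpoly_eval a 0 = 0"
  by (simp add: dpoly_eval_def)

lemma dpoly_eval_const_mult:
  "dpoly_eval a (Poly_Mapping.single 0 t * p) = t * dpoly_eval a p"
proof -
  have eq: "Poly_Mapping.single 0 t * p = Poly_Mapping.map ((*) t) p"
    by (simp add: mult_map_scale_conv_mult)
  \<comment> \<open>The inclusion is strict when \<open>t = 0\<close> and \<open>p\<close> is
    nonzero.\<close>
  have "Poly_Mapping.keys (Poly_Mapping.map ((*) t) p) \<subseteq> Poly_Mapping.keys p"
    by (auto simp: in_keys_iff Poly_Mapping.map.rep_eq when_def)
  then show ?thesis
    unfolding eq
    by (simp add: dpoly_eval_superset[of "Poly_Mapping.keys p"] Poly_Mapping.map.rep_eq
        sum_distrib_left mult.assoc in_keys_iff cong: sum.cong_simp)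
qed

text \<open>Evaluation at a point is additive, and a complex scalar \<open>t\<close> acts on
  \<open>M\<close> as the constant polynomial \<open>Poly_Mapping.single 0 t\<close>, so closure
  properties of the submodule pass to its values.\<close>

lemma subspace_value_space:
  assumes "dpoly_vec.subspace M"
  shows "vec.subspace (value_space M a)"
proof (rule vec.subspaceI)
  show "0 \<in> value_space M a"
    using dpoly_vec.subspace_0[OF assms] unfolding value_space_def
    by (auto intro!: exI[of _ 0] simp: dpoly_vec_eval_def vec_eq_iff dpoly_eval_0)
next
  fix v w assume "v \<in> value_space M a" "w \<in> value_space M a"
  then obtain m n where "m \<in> M" "n \<in> M"
    "v = dpoly_vec_eval (of_rat_vec a) m" "w = dpoly_vec_eval (of_rat_vec a) n"
    by (auto simp: value_space_def)
  then show "v + w \<in> value_space M a"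
    using dpoly_vec.subspace_add[OF assms] unfolding value_space_def
    by (auto intro!: exI[of _ "m + n"] simp: dpoly_vec_eval_def vec_eq_iff dpoly_eval_add)
next
  fix t v assume "v \<in> value_space M a"
  then obtain m where "m \<in> M" "v = dpoly_vec_eval (of_rat_vec a) m"
    by (auto simp: value_space_def)
  then show "t *s v \<in> value_space M a"
    using dpoly_vec.subspace_scale[OF assms] unfolding value_space_def
    by (auto intro!: exI[of _ "Poly_Mapping.single 0 t *s m"]
        simp: dpoly_vec_eval_def vec_eq_iff dpoly_eval_const_mult)
qed

text \<open>A basis of \<open>V\<close> together with \<open>w\<close> is independent, so some
  linear map kills \<open>V\<close> and fixes \<open>w\<close>. A coordinate of this map at which
  \<open>w\<close> is nonzero is the separating functional.\<close>

lemma subspace_separation: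
  fixes V :: "('a::field ^ 'q::finite) set"
  assumes V: "vec.subspace V" and w: "w \<notin> V"
  obtains c where "\<And>v. v \<in> V \<Longrightarrow> pairing v c = 0" "pairing w c \<noteq> 0"
proof -
  obtain B where B: "B \<subseteq> V" "vec.independent B" "V \<subseteq> vec.span B"
    using vec.basis_exists[of V] by metis
  have span: "vec.span B \<subseteq> V" using B V by (simp add: vec.span_minimal)
  have "vec.independent (insert w B)"
    using B w span by (auto simp: vec.independent_insert)
  then obtain g where g: "Vector_Spaces.linear (*s) (*s) g"
    and gB: "\<forall>x\<in>insert w B. g x = (if x = w then w else 0)"
    using vec.linear_independent_extend[of "insert w B" "\<lambda>x. if x = w then w else 0"]
    by blast
  have "g x = 0" if "x \<in> B" for x
    using gB B(1) w that by auto
  then have gV: "g v = 0" if "v \<in> V" for v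
    using vec.linear_eq_0_on_span[OF g, of B v] B(3) that by blast
  have "w \<noteq> 0" using w vec.subspace_0[OF V] by auto
  then obtain k where k: "w $ k \<noteq> 0" by (auto simp: vec_eq_iff)
  \<comment> \<open>Row \<open>k\<close> of the matrix of \<open>g\<close> represents the functional
    under the bilinear pairing.\<close>
  have pr: "pairing v (matrix g $ k) = g v $ k" for v
    using matrix_works[OF g, of v]
    by (auto simp: pairing_def matrix_vector_mult_def vec_eq_iff mult.commute)
  show thesis
    by (rule that[of "matrix g $ k"]) (use gV gB k in \<open>auto simp: pr\<close>)
qed

section \<open>Differential operators on exponential sums, and independence of exponentials\<close>

lemma of_real_of_rat: "of_real (of_rat q) = (of_rat q :: 'a::real_field)"
  by (induction q) (simp add: of_rat_rat)

lemma exp_fun_has_partial_derivative: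
  "((\<lambda>t. exp_fun a (x + t *\<^sub>R axis j 1)) has_vector_derivative
     \<i> * of_rat (a $ j) * exp_fun a x) (at 0)"
proof -
  have *: "pairing (of_rat_vec a) (x + t *\<^sub>R axis j 1) =
      pairing (of_rat_vec a) x + t * of_rat (a $ j)" for t :: real
    by (simp add: pairing_def of_rat_vec_def axis_def distrib_left sum.distrib
        if_distrib[of "\<lambda>y. _ * y"] cong: if_cong)
  \<comment> \<open>The derivative is taken in a complex variable \<open>z\<close> and then
    restricted to real \<open>t\<close>.\<close>
  have "((\<lambda>z. exp (\<i> * (complex_of_real (pairing (of_rat_vec a) x) + z * of_rat (a $ j))))
      has_field_derivative \<i> * of_rat (a $ j) * exp_fun a x) (at (of_real 0))"
    by (auto intro!: derivative_eq_intros simp: exp_fun_def)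
  from has_vector_derivative_real_field[OF this] show ?thesis
    by (simp add: exp_fun_def * of_real_of_rat)
qed

text \<open>The index set \<open>A\<close> is kept fixed rather than tied to the support, because
  coefficients with \<open>a $ j = 0\<close> are killed. The result has the same shape, so the rule
  can be iterated.\<close>

lemma D_op_exp_sum:
  "D_op j (\<lambda>x. \<Sum>a\<in>A. c a * exp_fun a x) = (\<lambda>x. \<Sum>a\<in>A. of_rat (a $ j) * c a * exp_fun a x)"
proof
  fix x
  have "((\<lambda>t. \<Sum>a\<in>A. c a * exp_fun a (x + t *\<^sub>R axis j 1)) has_vector_derivative
     (\<Sum>a\<in>A. c a * (\<i> * of_rat (a $ j) * exp_fun a x))) (at 0)"
    by (intro has_vector_derivative_sum has_vector_derivative_mult_right exp_fun_has_partial_derivative)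
  then have "vector_derivative (\<lambda>t. \<Sum>a\<in>A. c a * exp_fun a (x + t *\<^sub>R axis j 1)) (at 0) =
     (\<Sum>a\<in>A. c a * (\<i> * of_rat (a $ j) * exp_fun a x))"
    by (rule vector_derivative_at)
  then show "D_op j (\<lambda>x. \<Sum>a\<in>A. c a * exp_fun a x) x = (\<Sum>a\<in>A. of_rat (a $ j) * c a * exp_fun a x)"
    by (simp add: D_op_def sum_distrib_left sum_negf[symmetric] mult_ac)
qed

lemma D_op_funpow_exp_sum:
  "(D_op j ^^ k) (\<lambda>x. \<Sum>a\<in>A. c a * exp_fun a x) =
   (\<lambda>x. \<Sum>a\<in>A. of_rat (a $ j) ^ k * c a * exp_fun a x)"
  by (induction k) (simp_all add: D_op_exp_sum, simp add: mult.assoc)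

lemma D_monom_exp_sum:
  "D_monom \<alpha> (\<lambda>x. \<Sum>a\<in>A. c a * exp_fun a x) =
   (\<lambda>x. \<Sum>a\<in>A. (\<Prod>j\<in>UNIV. of_rat (a $ j) ^ Poly_Mapping.lookup \<alpha> j) * c a * exp_fun a x)"
proof -
  \<comment> \<open>Generalised to any list of variables for induction; distinctness makes the fold
    a product over a set.\<close>
  have "foldr (\<lambda>j. D_op j ^^ Poly_Mapping.lookup \<alpha> j) js (\<lambda>x. \<Sum>a\<in>A. c a * exp_fun a x) =
     (\<lambda>x. \<Sum>a\<in>A. (\<Prod>j\<in>set js. of_rat (a $ j) ^ Poly_Mapping.lookup \<alpha> j) * c a * exp_fun a x)"
    if "distinct js" for js
    using that by (induction js) (simp_all add: D_op_funpow_exp_sum, simp add: mult.assoc)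
  from this[of "sorted_list_of_set UNIV"] show ?thesis
    by (simp add: D_monom_def)
qed

lemma dpoly_act_exp_sum:
  "dpoly_act p (\<lambda>x. \<Sum>a\<in>A. c a * exp_fun a x) =
   (\<lambda>x. \<Sum>a\<in>A. dpoly_eval (of_rat_vec a) p * c a * exp_fun a x)"
  unfolding dpoly_act_def D_monom_exp_sum dpoly_eval_def
  by (simp add: sum_distrib_left sum_distrib_right of_rat_vec_def mult.assoc sum.swap[of _ A])

lemma exp_fun_independent:
  assumes "finite A" "\<And>x. (\<Sum>a\<in>A. c a * exp_fun a x) = 0" "a \<in> A"
  shows "c a = 0"
  using assms
proof (induction A arbitrary: c a rule: finite_induct)
  case empty
  then show ?case by simp
next
  case (insert b A)
  let ?f = "\<lambda>x. \<Sum>a\<in>insert b A. c a * exp_fun a x"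
  \<comment> \<open>The zero function is written as an empty exponential sum so that
    \<open>D_op_exp_sum\<close> also shows that its derivative vanishes.\<close>
  have f0: "?f = (\<lambda>x. \<Sum>a\<in>{}. c a * exp_fun a x)"
    using insert.prems(1) by (simp add: fun_eq_iff)
  have A0: "c a = 0" if a: "a \<in> A" for a
  proof -
    obtain j where j: "a $ j \<noteq> b $ j"
      using a insert.hyps by (metis vec_eq_iff)
    \<comment> \<open>Applying D_j - b_j to the relation removes the frequency b.\<close>
    have "(\<Sum>a\<in>A. ((of_rat (a $ j) - of_rat (b $ j)) * c a) * exp_fun a x) = 0" for x
    proof -
      have "(\<Sum>a\<in>insert b A. of_rat (a $ j) * c a * exp_fun a x) = 0"
        using fun_cong[OF D_op_exp_sum[of j c "insert b A"], of x]
        unfolding f0 D_op_exp_sum by simp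
      moreover have "of_rat (b $ j) * (\<Sum>a\<in>insert b A. c a * exp_fun a x) = 0"
        by (simp only: insert.prems(1) mult_zero_right)
      ultimately have "(\<Sum>a\<in>insert b A. ((of_rat (a $ j) - of_rat (b $ j)) * c a) * exp_fun a x) = 0"
        unfolding sum_distrib_left by (simp only: left_diff_distrib sum_subtractf mult.assoc diff_self)
      then show ?thesis using insert.hyps by simp
    qed
    from insert.IH[OF this a] j show ?thesis by simp
  qed
  \<comment> \<open>With the other coefficients gone, evaluation at the origin isolates
    \<open>c b\<close>.\<close>
  then have "c b * exp_fun b 0 = 0"
    using insert.prems(1)[of 0] insert.hyps by simp
  then have "c b = 0" by (simp add: exp_fun_def)
  with A0 insert.prems(2) show ?case by auto
qed

section \<open>Vector signals, the behavior and its Willems closure\<close>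

lemma exp_sum_vec_superset:
  assumes "finite A" "{a. c a \<noteq> 0} \<subseteq> A"
  shows "exp_sum_vec c $ i = (\<lambda>x. \<Sum>a\<in>A. c a $ i * exp_fun a x)"
  unfolding exp_sum_vec_def using assms
  by (auto intro!: sum.mono_neutral_left simp: fun_eq_iff)

lemma pairing_zero_right: "pairing v 0 = 0"
  by (simp add: pairing_def)

text \<open>After exchanging sums, the coefficient of \<open>exp_fun a\<close> in the equation is
  the pairing of \<open>r(a)\<close> with \<open>c a\<close>, and independence makes each one
  vanish. Outside the support the condition is trivial.\<close>

lemma annihilates_exp_sum_vec:
  assumes fin: "finite {a. c a \<noteq> 0}"
  shows "annihilates r (exp_sum_vec c) \<longleftrightarrow>
    (\<forall>a. pairing (dpoly_vec_eval (of_rat_vec a) r) (c a) = 0)"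
proof -
  let ?A = "{a. c a \<noteq> 0}"
  let ?p = "\<lambda>a. pairing (dpoly_vec_eval (of_rat_vec a) r) (c a)"
  have "(\<Sum>j\<in>UNIV. dpoly_act (r $ j) (exp_sum_vec c $ j) x) = (\<Sum>a\<in>?A. ?p a * exp_fun a x)" for x
    by (simp add: exp_sum_vec_superset[OF fin order_refl] dpoly_act_exp_sum pairing_def
        dpoly_vec_eval_def sum_distrib_right sum.swap[of _ ?A])
  then have "annihilates r (exp_sum_vec c) \<longleftrightarrow> (\<forall>x. (\<Sum>a\<in>?A. ?p a * exp_fun a x) = 0)"
    by (simp add: annihilates_def)
  also have "\<dots> \<longleftrightarrow> (\<forall>a\<in>?A. ?p a = 0)"
    using exp_fun_independent[OF fin, of ?p] by auto
  also have "\<dots> \<longleftrightarrow> (\<forall>a. ?p a = 0)"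
    by (metis (mono_tags, lifting) mem_Collect_eq pairing_zero_right)
  finally show ?thesis .
qed

lemma PT_fin_vec_iff:
  fixes f :: "('n::finite) signal ^ 'q::finite"
  shows "(\<forall>j. f $ j \<in> PT_fin) \<longleftrightarrow> (\<exists>c. finite {a. c a \<noteq> 0} \<and> f = exp_sum_vec c)"
proof
  assume "\<forall>j. f $ j \<in> PT_fin"
  then have "\<forall>j. \<exists>c. finite {a. c a \<noteq> 0} \<and> f $ j = (\<lambda>x. \<Sum>a | c a \<noteq> 0. c a * exp_fun a x)"
    by (auto simp: PT_fin_def)
  then obtain d where d: "\<And>j. finite {a. d j a \<noteq> 0}"
    "\<And>j. f $ j = (\<lambda>x. \<Sum>a | d j a \<noteq> 0. d j a * exp_fun a x)"
    unfolding choice_iff by blast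
  define c where "c a = (\<chi> j. d j a)" for a
  \<comment> \<open>The components may have different supports; their finite union serves as a
    common one.\<close>
  have supp: "{a. c a \<noteq> 0} = (\<Union>j. {a. d j a \<noteq> 0})"
    by (auto simp: c_def vec_eq_iff)
  then have fin: "finite {a. c a \<noteq> 0}" using d(1) by simp
  have "f $ j = exp_sum_vec c $ j" for j
    unfolding exp_sum_vec_superset[OF fin order_refl] d(2)
    using fin by (auto intro!: sum.mono_neutral_cong_left simp: fun_eq_iff supp c_def vec_eq_iff)
  with fin show "\<exists>c. finite {a. c a \<noteq> 0} \<and> f = exp_sum_vec c"
    by (auto simp: vec_eq_iff)
next
  assume "\<exists>c. finite {a. c a \<noteq> 0} \<and> f = exp_sum_vec c"
  then obtain c where fin: "finite {a. c a \<noteq> 0}" and f: "f = exp_sum_vec c" by blast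
  show "\<forall>j. f $ j \<in> PT_fin"
  proof
    fix j
    have sub: "{a. c a $ j \<noteq> 0} \<subseteq> {a. c a \<noteq> 0}" by auto
    have eq: "f $ j = (\<lambda>x. \<Sum>a | c a $ j \<noteq> 0. c a $ j * exp_fun a x)"
      unfolding f exp_sum_vec_superset[OF fin order_refl]
      using fin sub by (auto intro!: sum.mono_neutral_right simp: fun_eq_iff)
    show "f $ j \<in> PT_fin"
      unfolding PT_fin_def
      by (intro CollectI exI[of _ "\<lambda>a. c a $ j"] conjI eq finite_subset[OF sub fin])
  qed
qed

lemma behavior_PT_fin:
  fixes M :: "(('n::{finite,linorder}) dpoly ^ 'q::finite) set"
  shows "behavior PT_fin M =
    {exp_sum_vec c | c. finite {a. c a \<noteq> 0} \<and> (\<forall>a. \<forall>v\<in>value_space M a. pairing v (c a) = 0)}"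
  unfolding behavior_def PT_fin_vec_iff
  by (auto simp: annihilates_exp_sum_vec value_space_def) blast

lemma willems_closure_PT_fin:
  fixes M :: "(('n::{finite,linorder}) dpoly ^ 'q::finite) set"
  assumes M: "dpoly_vec.subspace M"
  shows "willems_closure PT_fin M = {r. \<forall>a. dpoly_vec_eval (of_rat_vec a) r \<in> value_space M a}"
proof (intro equalityI subsetI CollectI allI)
  fix r a assume r: "r \<in> willems_closure PT_fin M"
  show "dpoly_vec_eval (of_rat_vec a) r \<in> value_space M a"
  proof (rule ccontr)
    assume "dpoly_vec_eval (of_rat_vec a) r \<notin> value_space M a"
    then obtain w where w: "\<And>v. v \<in> value_space M a \<Longrightarrow> pairing v w = 0"
      "pairing (dpoly_vec_eval (of_rat_vec a) r) w \<noteq> 0"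
      using subspace_separation[OF subspace_value_space[OF M]] by metis
    \<comment> \<open>The test signal is the single exponential of frequency \<open>a\<close> with
      the separating vector as coefficient: it lies in the behavior, yet \<open>r\<close> does not
      annihilate it.\<close>
    let ?c = "\<lambda>b. if b = a then w else 0"
    have fin: "finite {b. ?c b \<noteq> 0}"
      by (rule finite_subset[of _ "{a}"]) auto
    have "exp_sum_vec ?c \<in> behavior PT_fin M"
      unfolding behavior_PT_fin using fin w(1)
      by (intro CollectI exI[of _ ?c]) (auto simp: pairing_def)
    with r have "annihilates r (exp_sum_vec ?c)"
      by (auto simp: willems_closure_def behavior_annihilator_def)
    with w(2) show False
      unfolding annihilates_exp_sum_vec[OF fin] by (auto dest: spec[of _ a])
  qed
next
  fix r assume "r \<in> {r. \<forall>a. dpoly_vec_eval (of_rat_vec a) r \<in> value_space M a}"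
  then show "r \<in> willems_closure PT_fin M"
    by (auto simp: willems_closure_def behavior_annihilator_def behavior_PT_fin
        annihilates_exp_sum_vec)
qed

theorem mainTheorem9:
  fixes M :: "(('n::{finite,linorder}) dpoly ^ 'q::finite) set"
  assumes "CARD('n) \<ge> 2"
    and "dpoly_vec.subspace M"
  shows "(\<forall>a. vec.subspace (value_space M a))
    \<and> behavior PT_fin M =
        {exp_sum_vec c | c :: (rat, 'n) vec \<Rightarrow> complex ^ 'q.
           finite {a. c a \<noteq> 0} \<and> (\<forall>a. \<forall>v\<in>value_space M a. pairing v (c a) = 0)}
    \<and> willems_closure PT_fin M =
        {r. \<forall>a. dpoly_vec_eval (of_rat_vec a) r \<in> value_space M a}"
  using subspace_value_space[OF assms(2)] behavior_PT_fin willems_closure_PT_fin[OF assms(2)]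
  by blast

end
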